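(* Let $B$ be a standard Brownian bridge on $[0,T]$, $n\ge 1$, $0=t_0\le t_1\le\cdots\le t_n=T$, and, for $i\ge1$, let $$e_i^B(t)=\sqrt{\tfrac2T}\,\sin\Big(\pi i\,\tfrac tT\Big),\qquad\lambda_i^B=\Big(\frac{T}{\pi i}\Big)^2 .$$ Then for every $i\ge1$, $$\mathbb{E}\Big[\int_0^TB_se_i^B(s)\,ds\,\Big|\,B_{t_0},\dots,B_{t_n}\Big]=\sum_{j=0}^n\alpha_{ij}B_{t_j}\quad\text{a.s.},$$ where, for $1\le j<n$: - if $t_{j-1}<t_j<t_{j+1}$, $\ \alpha_{ij}=\lambda_i^B\,\dfrac{(t_{j+1}-t_{j-1})e_i^B(t_j)-(t_{j+1}-t_j)e_i^B(t_{j-1})-(t_j-t_{j-1})e_i^B(t_{j+1})}{(t_{j+1}-t_j)(t_j-t_{j-1})}$; - if $t_{j-1}=t_j<t_{j+1}$, $\ \alpha_{ij}=\lambda_i^B\Big((e_i^B)'(t_j)-\dfrac{e_i^B(t_{j+1})-e_i^B(t_j)}{t_{j+1}-t_j}\Big)$; - if $t_{j-1}<t_j=t_{j+1}$, $\ \alpha_{ij}=\lambda_i^B\Big(\dfrac{e_i^B(t_j)-e_i^B(t_{j-1})}{t_j-t_{j-1}}-(e_i^B)'(t_j)\Big)$; - if $t_{j-1}=t_j=t_{j+1}$, $\ \alpha_{ij}=0$; and $$\alpha_{i0}=\lambda_i^B\Big((e_i^B)'(t_0)-\frac{e_i^B(t_1)-e_i^B(t_0)}{t_1-t_0}\Big)\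 \text{if }t_1\ne t_0,\quad\alpha_{i0}=0\ \text{otherwise},$$ $$\alpha_{in}=\lambda_i^B\Big(\frac{e_i^B(t_n)-e_i^B(t_{n-1})}{t_n-t_{n-1}}-(e_i^B)'(t_n)\Big)\ \text{if }t_n\ne t_{n-1},\quad\alpha_{in}=0\ \text{otherwise}.$$
   Context: $(e_i^B,\lambda_i^B)_{i\ge1}$ is the Karhunen-Loève eigensystem of the standard Brownian bridge on $[0,T]$ (centered Gaussian, covariance $\min(s,t)-st/T$). *)

theory Defs
  imports "HOL-Probability.Probability"
begin

text \<open>A constant counts as Gaussian (variance 0): linear combinations of the values of a Brownian
  bridge can be degenerate, for instance at the two endpoints.\<close>

definition gaussian_rv :: "'a measure \<Rightarrow> ('a \<Rightarrow> real) \<Rightarrow> bool" where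
  "gaussian_rv M X \<longleftrightarrow>
     X \<in> borel_measurable M \<and>
     ((\<exists>\<mu> \<sigma>. \<sigma> > 0 \<and> distributed M lborel X (\<lambda>x. ennreal (normal_density \<mu> \<sigma> x))) \<or>
      (\<exists>\<mu>. AE \<omega> in M. X \<omega> = \<mu>))"

definition gaussian_process :: "'a measure \<Rightarrow> 'i set \<Rightarrow> ('i \<Rightarrow> 'a \<Rightarrow> real) \<Rightarrow> bool" where
  "gaussian_process M I X \<longleftrightarrow>
     (\<forall>J c. finite J \<and> J \<subseteq> I \<longrightarrow> gaussian_rv M (\<lambda>\<omega>. \<Sum>t\<in>J. c t * X t \<omega>))"

definition covariance :: "'a measure \<Rightarrow> ('a \<Rightarrow> real) \<Rightarrow> ('a \<Rightarrow> real) \<Rightarrow> real" where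
  "covariance M X Y =
     (\<integral>\<omega>. (X \<omega> - (\<integral>\<omega>'. X \<omega>' \<partial>M)) * (Y \<omega> - (\<integral>\<omega>'. Y \<omega>' \<partial>M)) \<partial>M)"

text \<open>Every path is continuous, not just almost every one: since \<open>M\<close> need not be complete, this is
  what makes pathwise integrals of \<open>B\<close> random variables.\<close>

definition brownian_bridge :: "'a measure \<Rightarrow> real \<Rightarrow> (real \<Rightarrow> 'a \<Rightarrow> real) \<Rightarrow> bool" where
  "brownian_bridge M T B \<longleftrightarrow>
     gaussian_process M {0..T} B \<and>
     (\<forall>s\<in>{0..T}. (\<integral>\<omega>. B s \<omega> \<partial>M) = 0) \<and>
     (\<forall>s\<in>{0..T}. \<forall>t\<in>{0..T}. covariance M (B s) (B t) = min s t - s * t / T) \<and>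
     (\<forall>\<omega>\<in>space M. continuous_on {0..T} (\<lambda>s. B s \<omega>))"

definition generated_sigma :: "'a measure \<Rightarrow> 'i set \<Rightarrow> ('i \<Rightarrow> 'a \<Rightarrow> real) \<Rightarrow> 'a measure" where
  "generated_sigma M I X =
     sigma (space M) (\<Union>i\<in>I. {X i -` A \<inter> space M | A. A \<in> sets borel})"

definition eB :: "real \<Rightarrow> nat \<Rightarrow> real \<Rightarrow> real" where
  "eB T i t = sqrt (2 / T) * sin (pi * real i * (t / T))"

definition lambdaB :: "real \<Rightarrow> nat \<Rightarrow> real" where
  "lambdaB T i = (T / (pi * real i))\<^sup>2"

definition alphaB :: "real \<Rightarrow> nat \<Rightarrow> (nat \<Rightarrow> real) \<Rightarrow> nat \<Rightarrow> nat \<Rightarrow> real" where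
  "alphaB T n t i j =
     (if j = 0 then
        (if t 1 \<noteq> t 0 then
           lambdaB T i * (deriv (eB T i) (t 0) - (eB T i (t 1) - eB T i (t 0)) / (t 1 - t 0))
         else 0)
      else if j = n then
        (if t n \<noteq> t (n - 1) then
           lambdaB T i *
             ((eB T i (t n) - eB T i (t (n - 1))) / (t n - t (n - 1)) - deriv (eB T i) (t n))
         else 0)
      else if t (j - 1) < t j \<and> t j < t (j + 1) then
        lambdaB T i *
          (((t (j + 1) - t (j - 1)) * eB T i (t j)
              - (t (j + 1) - t j) * eB T i (t (j - 1))
              - (t j - t (j - 1)) * eB T i (t (j + 1)))
            / ((t (j + 1) - t j) * (t j - t (j - 1))))
      else if t (j - 1) = t j \<and> t j < t (j + 1) then
        lambdaB T i *
          (deriv (eB T i) (t j) - (eB T i (t (j + 1)) - eB T i (t j)) / (t (j + 1) - t j))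
      else if t (j - 1) < t j \<and> t j = t (j + 1) then
        lambdaB T i *
          ((eB T i (t j) - eB T i (t (j - 1))) / (t j - t (j - 1)) - deriv (eB T i) (t j))
      else 0)"

end

theory Submission
  imports Defs
begin

text \<open>
  Let \<open>\<F>\<close> be the \<open>\<sigma>\<close>-algebra of the observations \<open>B (t 0), ..., B (t n)\<close>.
  Conditional expectation commutes with the time integral, so only \<open>E[B s | \<F>]\<close> is needed for
  each single time \<open>s\<close>. Between two neighbouring grid points \<open>a < b\<close> it is the linear
  interpolation of \<open>B a\<close> and \<open>B b\<close>: as the covariance function \<open>s \<mapsto> min s r - s * r / T\<close> is
  affine on \<open>[a, b]\<close> for every \<open>r\<close> outside \<open>]a, b[\<close>, the interpolation error is uncorrelated with all
  observations, hence, by joint Gaussianity, its integral over every event of \<open>\<F>\<close> vanishes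
  (\<open>brownian_bridge_interpolation\<close>). It remains to integrate an affine function against the
  eigenfunction \<open>eB T i\<close>, which is elementary because \<open>eB T i = - lambdaB T i * (eB T i)''\<close>
  (\<open>integral_linear_times_eB\<close>). Every nondegenerate subinterval thus contributes a weight to
  each of its two endpoints, and \<open>alphaB\<close> collects at \<open>t j\<close> the weights coming from the
  subintervals on its left and on its right (\<open>alphaB_eq_weights\<close>); the case distinction in
  its definition only records which of the two subintervals are nondegenerate.

  The passage from ``uncorrelated'' to ``integral zero over \<open>\<F>\<close>'' goes through characteristic
  functions. For a centred Gaussian pair
  \<open>(D, G)\<close> the characteristic function of \<open>u * D + G\<close> is even in \<open>u\<close> once \<open>D\<close> and \<open>G\<close> are
  uncorrelated, so its derivative at \<open>u = 0\<close> gives \<open>E[D * iexp G] = 0\<close>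
  (\<open>gaussian_uncorrelated_iexp\<close>). With \<open>G\<close> ranging over the linear combinations of the
  observations, this says that the signed measure with density \<open>D\<close>, pushed forward by the
  observations, has Fourier transform zero. The one-dimensional uniqueness theorem of Levy,
  applied to one coordinate at a time, shows that it vanishes on rectangles
  (\<open>weight_zero_on_rectangles\<close>), and Dynkin's \<open>\<pi>\<close>-\<open>\<lambda>\<close> theorem extends this to \<open>\<F>\<close>.
\<close>

section \<open>Integrable weights with vanishing Fourier transform\<close>

lemma (in prob_space) integrable_real_iexp:
  fixes W :: "'a \<Rightarrow> complex" and Y :: "'a \<Rightarrow> real"
  assumes "integrable M W" "Y \<in> borel_measurable M"
  shows "integrable M (\<lambda>\<omega>. W \<omega> * iexp (Y \<omega>))"
proof (rule Bochner_Integration.integrable_bound[OF assms(1)])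
  have [measurable]: "W \<in> borel_measurable M" "Y \<in> borel_measurable M" using assms by auto
  show "(\<lambda>\<omega>. W \<omega> * iexp (Y \<omega>)) \<in> borel_measurable M" by measurable
qed (auto simp: norm_mult)

text \<open>The positive and the negative part of \<open>W\<close> have the same mass (take \<open>v = 0\<close>). Normalised by
  it, both are densities of probability measures whose images under \<open>X\<close> have equal
  characteristic functions, so the images agree.\<close>

lemma (in prob_space) real_weight_zero_if_char_zero:
  fixes W X :: "'a \<Rightarrow> real"
  assumes W: "integrable M W" and X[measurable]: "X \<in> borel_measurable M"
    and zero: "\<And>v. (\<integral>\<omega>. complex_of_real (W \<omega>) * iexp (v * X \<omega>) \<partial>M) = 0"
    and A[measurable]: "A \<in> sets borel"
  shows "(\<integral>\<omega>. W \<omega> * indicator A (X \<omega>) \<partial>M) = 0"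
proof -
  have [measurable]: "W \<in> borel_measurable M" using W by auto
  define p where "p \<omega> = max 0 (W \<omega>)" for \<omega>
  define q where "q \<omega> = max 0 (- W \<omega>)" for \<omega>
  have [measurable]: "p \<in> borel_measurable M" "q \<in> borel_measurable M"
    unfolding p_def[abs_def] q_def[abs_def] by measurable
  have pq: "p \<omega> - q \<omega> = W \<omega>" "0 \<le> p \<omega>" "0 \<le> q \<omega>" for \<omega>
    by (auto simp: p_def q_def)
  have ip: "integrable M p" and iq: "integrable M q"
    unfolding p_def[abs_def] q_def[abs_def] using W by auto
  have split: "(\<integral>\<omega>. p \<omega> *\<^sub>R iexp (v * X \<omega>) \<partial>M) = (\<integral>\<omega>. q \<omega> *\<^sub>R iexp (v * X \<omega>) \<partial>M)" for v
  proof -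
    have i: "integrable M (\<lambda>\<omega>. complex_of_real (p \<omega>) * iexp (v * X \<omega>))"
         "integrable M (\<lambda>\<omega>. complex_of_real (q \<omega>) * iexp (v * X \<omega>))"
      by (rule integrable_real_iexp, use ip iq in simp, simp)+
    have "0 = (\<integral>\<omega>. complex_of_real (p \<omega> - q \<omega>) * iexp (v * X \<omega>) \<partial>M)"
      using zero[of v] by (simp only: pq)
    also have "\<dots> = (\<integral>\<omega>. complex_of_real (p \<omega>) * iexp (v * X \<omega>) \<partial>M) -
        (\<integral>\<omega>. complex_of_real (q \<omega>) * iexp (v * X \<omega>) \<partial>M)"
      by (subst Bochner_Integration.integral_diff[OF i, symmetric]) (simp add: algebra_simps)
    finally show ?thesis by (simp add: scaleR_conv_of_real)
  qed
  define c where "c = (\<integral>\<omega>. p \<omega> \<partial>M)"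
  have cq: "c = (\<integral>\<omega>. q \<omega> \<partial>M)"
    using split[of 0] unfolding c_def by (simp add: scaleR_conv_of_real)
  show ?thesis
  proof (cases "c = 0")
    case True
    have "AE \<omega> in M. p \<omega> = 0"
      using integral_nonneg_eq_0_iff_AE[OF ip] True pq by (simp add: c_def)
    moreover have "AE \<omega> in M. q \<omega> = 0"
      using integral_nonneg_eq_0_iff_AE[OF iq] True cq pq by simp
    ultimately have "AE \<omega> in M. W \<omega> * indicator A (X \<omega>) = 0"
      by eventually_elim (metis pq(1) diff_self mult_zero_left)
    then show ?thesis by (rule integral_eq_zero_AE)
  next
    case False
    then have c: "c > 0" using pq by (simp add: c_def order_less_le)
    define \<mu> where "\<mu> f = distr (density M (\<lambda>\<omega>. ennreal (f \<omega> / c))) borel X" for f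
    have rdist: "real_distribution (\<mu> f)"
      and int: "\<And>g. g \<in> borel_measurable borel \<Longrightarrow>
        (\<integral>x. g x \<partial>\<mu> f) = (\<integral>\<omega>. (f \<omega> / c) *\<^sub>R (g (X \<omega>) :: complex) \<partial>M)"
      and meas: "measure (\<mu> f) A = (\<integral>\<omega>. f \<omega> * indicator A (X \<omega>) \<partial>M) / c"
      if f[measurable]: "f \<in> borel_measurable M" and f0: "\<And>\<omega>. 0 \<le> f \<omega>" and fi: "integrable M f"
        and fc: "(\<integral>\<omega>. f \<omega> \<partial>M) = c" for f
    proof -
      have "emeasure (density M (\<lambda>\<omega>. ennreal (f \<omega> / c))) (space M) = (\<integral>\<^sup>+\<omega>. ennreal (f \<omega> / c) \<partial>M)"
        by (subst emeasure_density) (auto intro!: nn_integral_cong)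
      also have "\<dots> = ennreal (\<integral>\<omega>. f \<omega> / c \<partial>M)"
        using fi f0 c by (intro nn_integral_eq_integral) auto
      also have "\<dots> = 1" using fc c by simp
      finally interpret N: prob_space "density M (\<lambda>\<omega>. ennreal (f \<omega> / c))"
        by (intro prob_spaceI) simp
      show rd: "real_distribution (\<mu> f)"
        unfolding \<mu>_def by (rule N.real_distribution_distr) simp
      have int_general: "(\<integral>x. g x \<partial>\<mu> f) = (\<integral>\<omega>. (f \<omega> / c) *\<^sub>R (g (X \<omega>)) \<partial>M)"
        if [measurable]: "g \<in> borel_measurable borel" for g :: "real \<Rightarrow> 'z::{banach, second_countable_topology}"
        unfolding \<mu>_def using f0 c
        by (subst integral_distr) (auto simp: integral_density)
      then show "\<And>g. g \<in> borel_measurable borel \<Longrightarrow>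
        (\<integral>x. g x \<partial>\<mu> f) = (\<integral>\<omega>. (f \<omega> / c) *\<^sub>R (g (X \<omega>) :: complex) \<partial>M)" by blast
      interpret P: real_distribution "\<mu> f" by (rule rd)
      have "measure (\<mu> f) A = (\<integral>x. indicator A x \<partial>\<mu> f)" by simp
      also have "\<dots> = (\<integral>\<omega>. (f \<omega> / c) *\<^sub>R (indicator A (X \<omega>)) \<partial>M)"
        by (subst int_general) auto
      also have "\<dots> = (\<integral>\<omega>. f \<omega> * indicator A (X \<omega>) / c \<partial>M)"
        by (rule Bochner_Integration.integral_cong) auto
      finally show "measure (\<mu> f) A = (\<integral>\<omega>. f \<omega> * indicator A (X \<omega>) \<partial>M) / c" by simp
    qed
    have "char (\<mu> p) v = char (\<mu> q) v" for v
    proof -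
      have "(\<integral>\<omega>. (p \<omega> / c) *\<^sub>R iexp (v * X \<omega>) \<partial>M) = (\<integral>\<omega>. p \<omega> *\<^sub>R iexp (v * X \<omega>) \<partial>M) /\<^sub>R c"
        by (simp add: divide_inverse_commute del: of_real_mult flip: scaleR_scaleR)
      also have "\<dots> = (\<integral>\<omega>. (q \<omega> / c) *\<^sub>R iexp (v * X \<omega>) \<partial>M)"
        by (simp add: split divide_inverse_commute del: of_real_mult flip: scaleR_scaleR)
      finally show ?thesis
        unfolding char_def by (subst (1 2) int) (use pq ip iq c_def cq in auto)
    qed
    then have "\<mu> p = \<mu> q"
      using pq ip iq c_def cq by (intro Levy_uniqueness rdist) auto
    then have "(\<integral>\<omega>. p \<omega> * indicator A (X \<omega>) \<partial>M) / c = (\<integral>\<omega>. q \<omega> * indicator A (X \<omega>) \<partial>M) / c"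
      by (subst (1 2) meas[symmetric]) (use pq ip iq c_def cq in auto)
    then have eq: "(\<integral>\<omega>. p \<omega> * indicator A (X \<omega>) \<partial>M) = (\<integral>\<omega>. q \<omega> * indicator A (X \<omega>) \<partial>M)"
      using c by simp
    have ind: "integrable M (\<lambda>\<omega>. f \<omega> * indicator A (X \<omega>))" if "integrable M f" for f :: "'a \<Rightarrow> real"
    proof (rule Bochner_Integration.integrable_bound[OF that])
      have [measurable]: "f \<in> borel_measurable M" using that by auto
      show "(\<lambda>\<omega>. f \<omega> * indicator A (X \<omega>)) \<in> borel_measurable M" by measurable
    qed (auto simp: indicator_def)
    have "(\<integral>\<omega>. W \<omega> * indicator A (X \<omega>) \<partial>M) =
        (\<integral>\<omega>. p \<omega> * indicator A (X \<omega>) - q \<omega> * indicator A (X \<omega>) \<partial>M)"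
      by (simp only: left_diff_distrib[symmetric] pq)
    then show ?thesis
      using eq ind[OF ip] ind[OF iq] by simp
  qed
qed

text \<open>Complex weights are needed for the induction over the coordinates below, where the factors
  \<open>iexp (v k * X k)\<close> of the coordinates not yet treated are absorbed into the weight. Since the
  hypothesis is assumed for \<open>v\<close> and \<open>- v\<close>, it passes to the conjugate of \<open>W\<close>, hence to its real
  and imaginary parts.\<close>

lemma (in prob_space) weight_zero_if_char_zero:
  fixes W :: "'a \<Rightarrow> complex" and X :: "'a \<Rightarrow> real"
  assumes W: "integrable M W" and X[measurable]: "X \<in> borel_measurable M"
    and zero: "\<And>v. (\<integral>\<omega>. W \<omega> * iexp (v * X \<omega>) \<partial>M) = 0"
    and A[measurable]: "A \<in> sets borel"
  shows "(\<integral>\<omega>. W \<omega> * indicator A (X \<omega>) \<partial>M) = 0"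
proof -
  have [measurable]: "W \<in> borel_measurable M" using W by auto
  have cnj0: "(\<integral>\<omega>. cnj (W \<omega>) * iexp (v * X \<omega>) \<partial>M) = 0" for v
  proof -
    have "(\<integral>\<omega>. cnj (W \<omega>) * iexp (v * X \<omega>) \<partial>M) = (\<integral>\<omega>. cnj (W \<omega> * iexp (- v * X \<omega>)) \<partial>M)"
      by (rule Bochner_Integration.integral_cong) (auto simp: exp_cnj)
    also have "\<dots> = cnj (\<integral>\<omega>. W \<omega> * iexp (- v * X \<omega>) \<partial>M)" by (rule Bochner_Integration.integral_cnj)
    finally show ?thesis using zero[of "-v"] by simp
  qed
  have i1: "integrable M (\<lambda>\<omega>. W \<omega> * iexp (v * X \<omega>))"
    and i2: "integrable M (\<lambda>\<omega>. cnj (W \<omega>) * iexp (v * X \<omega>))" for v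
    by (rule integrable_real_iexp, use W in simp, simp)+
  have "(\<integral>\<omega>. Re (W \<omega>) * indicator A (X \<omega>) \<partial>M) = 0"
  proof (rule real_weight_zero_if_char_zero[OF _ X _ A])
    show "integrable M (\<lambda>\<omega>. Re (W \<omega>))" using W by simp
    fix v
    have "(\<integral>\<omega>. complex_of_real (Re (W \<omega>)) * iexp (v * X \<omega>) \<partial>M) =
      (\<integral>\<omega>. (W \<omega> * iexp (v * X \<omega>) + cnj (W \<omega>) * iexp (v * X \<omega>)) / 2 \<partial>M)"
      by (rule Bochner_Integration.integral_cong)
         (simp_all flip: distrib_right add: complex_add_cnj)
    then show "(\<integral>\<omega>. complex_of_real (Re (W \<omega>)) * iexp (v * X \<omega>) \<partial>M) = 0"
      using i1 i2 zero cnj0 by simp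
  qed
  moreover have "(\<integral>\<omega>. Im (W \<omega>) * indicator A (X \<omega>) \<partial>M) = 0"
  proof (rule real_weight_zero_if_char_zero[OF _ X _ A])
    show "integrable M (\<lambda>\<omega>. Im (W \<omega>))" using W by simp
    fix v
    have "(\<integral>\<omega>. complex_of_real (Im (W \<omega>)) * iexp (v * X \<omega>) \<partial>M) =
      (\<integral>\<omega>. (W \<omega> * iexp (v * X \<omega>) - cnj (W \<omega>) * iexp (v * X \<omega>)) / (2 * \<i>) \<partial>M)"
    proof (rule Bochner_Integration.integral_cong)
      fix \<omega>
      have "W \<omega> * z - cnj (W \<omega>) * z = (complex_of_real (Im (W \<omega>)) * z) * (2 * \<i>)" for z
        by (simp add: complex_diff_cnj flip: left_diff_distrib)
      then show "complex_of_real (Im (W \<omega>)) * iexp (v * X \<omega>) =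
          (W \<omega> * iexp (v * X \<omega>) - cnj (W \<omega>) * iexp (v * X \<omega>)) / (2 * \<i>)"
        by (metis complex_i_not_zero mult_eq_0_iff nonzero_mult_div_cancel_right zero_neq_numeral)
    qed simp
    then show "(\<integral>\<omega>. complex_of_real (Im (W \<omega>)) * iexp (v * X \<omega>) \<partial>M) = 0"
      using i1 i2 zero cnj0 by simp
  qed
  moreover have int: "integrable M (\<lambda>\<omega>. W \<omega> * indicator A (X \<omega>))"
    by (rule Bochner_Integration.integrable_bound[OF W]) (auto simp: indicator_def)
  have "Re (\<integral>\<omega>. W \<omega> * indicator A (X \<omega>) \<partial>M) = (\<integral>\<omega>. Re (W \<omega>) * indicator A (X \<omega>) \<partial>M)"
    by (subst integral_Re[OF int, symmetric]) (auto intro!: Bochner_Integration.integral_cong simp: indicator_def)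
  moreover have "Im (\<integral>\<omega>. W \<omega> * indicator A (X \<omega>) \<partial>M) = (\<integral>\<omega>. Im (W \<omega>) * indicator A (X \<omega>) \<partial>M)"
    by (subst integral_Im[OF int, symmetric]) (auto intro!: Bochner_Integration.integral_cong simp: indicator_def)
  ultimately show ?thesis by (simp add: complex_eq_iff)
qed

text \<open>Induction over the coordinates: for fixed \<open>u\<close> the hypothesis for \<open>insert x K\<close> is the
  hypothesis for \<open>K\<close> with weight \<open>W * iexp (u * X x)\<close>; the conclusion for all \<open>u\<close> then says
  that \<open>W\<close> times the indicators for \<open>K\<close> has vanishing Fourier transform along \<open>X x\<close>.\<close>

lemma (in prob_space) weight_zero_on_rectangles:
  fixes W :: "'a \<Rightarrow> complex" and X :: "'i \<Rightarrow> 'a \<Rightarrow> real"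
  assumes "finite K" "integrable M W"
    and "\<And>k. k \<in> K \<Longrightarrow> X k \<in> borel_measurable M"
    and "\<And>v. (\<integral>\<omega>. W \<omega> * iexp (\<Sum>k\<in>K. v k * X k \<omega>) \<partial>M) = 0"
    and "\<And>k. k \<in> K \<Longrightarrow> A k \<in> sets borel"
  shows "(\<integral>\<omega>. W \<omega> * (\<Prod>k\<in>K. indicator (A k) (X k \<omega>)) \<partial>M) = 0"
  using assms
proof (induction K arbitrary: W rule: finite_induct)
  case empty
  then show ?case by simp
next
  case (insert x K)
  have Wm[measurable]: "W \<in> borel_measurable M" using insert.prems(1) by auto
  have [measurable]: "X x \<in> borel_measurable M" "A x \<in> sets borel" using insert.prems by auto
  have P[measurable]: "(\<lambda>\<omega>. (\<Prod>k\<in>K. indicator (A k) (X k \<omega>)) :: complex) \<in> borel_measurable M"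
  proof (rule borel_measurable_prod)
    fix k assume "k \<in> K"
    then have [measurable]: "X k \<in> borel_measurable M" "A k \<in> sets borel" using insert.prems by auto
    show "(\<lambda>\<omega>. indicator (A k) (X k \<omega>) :: complex) \<in> borel_measurable M" by measurable
  qed
  have le1: "norm ((\<Prod>k\<in>K. indicator (A k) (X k \<omega>)) :: complex) \<le> 1" for \<omega>
    by (auto simp flip: prod_norm intro!: prod_le_1 simp: indicator_def)
  define V where "V \<omega> = W \<omega> * (\<Prod>k\<in>K. indicator (A k) (X k \<omega>))" for \<omega>
  have V: "integrable M V"
    unfolding V_def
    by (rule Bochner_Integration.integrable_bound[OF insert.prems(1)])
       (use le1 in \<open>auto simp: norm_mult intro!: mult_left_le\<close>)
  have "(\<integral>\<omega>. V \<omega> * indicator (A x) (X x \<omega>) \<partial>M) = 0"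
  proof (rule weight_zero_if_char_zero[OF V])
    fix u
    have "(\<integral>\<omega>. (W \<omega> * iexp (u * X x \<omega>)) * (\<Prod>k\<in>K. indicator (A k) (X k \<omega>)) \<partial>M) = 0"
    proof (rule insert.IH)
      show "integrable M (\<lambda>\<omega>. W \<omega> * iexp (u * X x \<omega>))"
        using insert.prems(1) by (rule integrable_real_iexp) simp
      fix v
      have "(\<integral>\<omega>. W \<omega> * iexp (\<Sum>k\<in>insert x K. (v(x := u)) k * X k \<omega>) \<partial>M) = 0"
        by (rule insert.prems(3))
      moreover have "(\<Sum>k\<in>insert x K. (v(x := u)) k * X k \<omega>) = u * X x \<omega> + (\<Sum>k\<in>K. v k * X k \<omega>)" for \<omega>
        using insert.hyps by (auto intro!: sum.cong)
      ultimately show "(\<integral>\<omega>. (W \<omega> * iexp (u * X x \<omega>)) * iexp (\<Sum>k\<in>K. v k * X k \<omega>) \<partial>M) = 0"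
        by (simp add: exp_add distrib_left mult.assoc del: of_real_sum of_real_mult)
    qed (use insert.prems in auto)
    then show "(\<integral>\<omega>. V \<omega> * iexp (u * X x \<omega>) \<partial>M) = 0"
      by (simp add: V_def mult_ac)
  qed auto
  then show ?case
    using insert.hyps by (simp add: V_def mult_ac)
qed

section \<open>The sigma-algebra generated by finitely many random variables\<close>

lemma space_generated_sigma [simp]: "space (generated_sigma M I X) = space M"
  unfolding generated_sigma_def by (rule space_measure_of) auto

lemma sets_generated_sigma:
  "sets (generated_sigma M I X) =
     sigma_sets (space M) (\<Union>i\<in>I. {X i -` A \<inter> space M | A. A \<in> sets borel})"
  unfolding generated_sigma_def by (rule sets_measure_of) auto

lemma measurable_generated_sigma:
  assumes "i \<in> I"
  shows "X i \<in> borel_measurable (generated_sigma M I X)"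
  by (rule measurableI) (use assms in \<open>auto simp: sets_generated_sigma intro!: sigma_sets.Basic\<close>)

lemma subalgebra_generated_sigma:
  assumes "\<And>i. i \<in> I \<Longrightarrow> X i \<in> borel_measurable M"
  shows "subalgebra M (generated_sigma M I X)"
  unfolding subalgebra_def sets_generated_sigma
  using assms by (auto intro!: sets.sigma_sets_subset measurable_sets)

text \<open>The rectangles form an intersection-stable generator, and the events over which \<open>W\<close>
  integrates to zero form a Dynkin system.\<close>

lemma (in prob_space) weight_zero_on_generated_sigma:
  fixes W :: "'a \<Rightarrow> real" and X :: "'i \<Rightarrow> 'a \<Rightarrow> real"
  assumes K: "finite K" and W: "integrable M W"
    and X: "\<And>k. k \<in> K \<Longrightarrow> X k \<in> borel_measurable M"
    and zero: "\<And>v. (\<integral>\<omega>. complex_of_real (W \<omega>) * iexp (\<Sum>k\<in>K. v k * X k \<omega>) \<partial>M) = 0"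
    and A: "A \<in> sets (generated_sigma M K X)"
  shows "(\<integral>\<omega>. indicator A \<omega> * W \<omega> \<partial>M) = 0"
proof -
  define R where "R C = {\<omega> \<in> space M. \<forall>k\<in>K. X k \<omega> \<in> C k}" for C :: "'i \<Rightarrow> real set"
  define G where "G = {R C | C. \<forall>k\<in>K. C k \<in> sets borel}"
  have R_in: "R C \<in> G" if "\<forall>k\<in>K. C k \<in> sets borel" for C
    using that unfolding G_def by blast
  have RM: "R C \<in> sets M" if C: "\<forall>k\<in>K. C k \<in> sets borel" for C
    unfolding R_def
  proof (rule sets.sets_Collect_finite_All[OF _ K])
    fix k assume k: "k \<in> K"
    note [measurable] = X[OF k] C[rule_format, OF k]
    show "{\<omega> \<in> space M. X k \<omega> \<in> C k} \<in> sets M" by measurable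
  qed
  have GM: "G \<subseteq> sets M" using RM by (auto simp: G_def)
  have Int: "Int_stable G"
  proof (rule Int_stableI)
    fix a b assume "a \<in> G" "b \<in> G"
    then obtain C D where C: "a = R C" "\<forall>k\<in>K. C k \<in> sets borel" and D: "b = R D" "\<forall>k\<in>K. D k \<in> sets borel"
      unfolding G_def by blast
    have "a \<inter> b = R (\<lambda>k. C k \<inter> D k)" unfolding C D R_def by auto
    then show "a \<inter> b \<in> G" using C D R_in[of "\<lambda>k. C k \<inter> D k"] by auto
  qed
  have "(\<Union>i\<in>K. {X i -` A \<inter> space M | A. A \<in> sets borel}) \<subseteq> G"
  proof clarsimp
    fix i and A :: "real set" assume i: "i \<in> K" and A: "A \<in> sets borel"
    have "X i -` A \<inter> space M = R (\<lambda>k. if k = i then A else UNIV)"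
      unfolding R_def using i by auto
    then show "X i -` A \<inter> space M \<in> G" using A R_in by auto
  qed
  then have A': "A \<in> sigma_sets (space M) G"
    using A sigma_sets_mono'[of _ G "space M"] by (auto simp: sets_generated_sigma)
  have "G \<subseteq> Pow (space M)" using GM sets.sets_into_space by blast
  from Int this A' show ?thesis
  proof (induction A rule: sigma_sets_induct_disjoint)
    case (basic A)
    then obtain C where C: "A = R C" "\<forall>k\<in>K. C k \<in> sets borel" by (auto simp: G_def)
    have prod: "(\<Prod>k\<in>K. indicator (C k) (X k \<omega>)) = (indicator A \<omega> :: complex)" if \<omega>: "\<omega> \<in> space M" for \<omega>
    proof (cases "\<omega> \<in> A")
      case True
      then show ?thesis unfolding C R_def by (simp add: indicator_def)
    next
      case False
      then obtain k where "k \<in> K" "X k \<omega> \<notin> C k" using \<omega> by (auto simp: C R_def)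
      then show ?thesis using False by (auto intro!: prod_zero[OF K] bexI[of _ k])
    qed
    have "(\<integral>\<omega>. complex_of_real (W \<omega>) * (\<Prod>k\<in>K. indicator (C k) (X k \<omega>)) \<partial>M) = 0"
      using K W X zero C by (intro weight_zero_on_rectangles) auto
    moreover have "(\<integral>\<omega>. complex_of_real (W \<omega>) * (\<Prod>k\<in>K. indicator (C k) (X k \<omega>)) \<partial>M) =
        (\<integral>\<omega>. complex_of_real (indicator A \<omega> * W \<omega>) \<partial>M)"
      by (rule Bochner_Integration.integral_cong) (auto simp: prod split: split_indicator)
    ultimately have "complex_of_real (\<integral>\<omega>. indicator A \<omega> * W \<omega> \<partial>M) = 0"
      by (simp only: integral_complex_of_real)
    then show ?case by simp
  next
    case empty
    show ?case by simp
  next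
    case (compl A)
    have "A \<in> sets M" using compl(1) GM sets.sigma_sets_subset by blast
    have iA: "integrable M (\<lambda>\<omega>. indicator A \<omega> * W \<omega>)"
      using integrable_mult_indicator[OF \<open>A \<in> sets M\<close> W] by simp
    have "(\<integral>\<omega>. indicator (space M - A) \<omega> * W \<omega> \<partial>M) = (\<integral>\<omega>. W \<omega> - indicator A \<omega> * W \<omega> \<partial>M)"
      by (rule Bochner_Integration.integral_cong) (auto simp: indicator_def)
    also have "\<dots> = (\<integral>\<omega>. W \<omega> \<partial>M)" using compl(2) W iA by simp
    also have "\<dots> = 0"
      using zero[of "\<lambda>_. 0"] by simp
    finally show ?case .
  next
    case (union A)
    have AM: "A i \<in> sets M" for i using union(2) GM sets.sigma_sets_subset by blast
    have "set_integrable M (\<Union>i. A i) W"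
      unfolding set_integrable_def using AM W by (intro integrable_mult_indicator) auto
    then have "(\<integral>\<omega>\<in>(\<Union>i. A i). W \<omega> \<partial>M) = (\<Sum>i. (\<integral>\<omega>\<in>A i. W \<omega> \<partial>M))"
      using union(1) AM by (intro lebesgue_integral_countable_add) (auto simp: disjoint_family_on_def)
    then show ?case using union(3) by (simp add: set_lebesgue_integral_def)
  qed
qed

section \<open>Gaussian random variables\<close>

lemma (in prob_space) gaussian_rv_integrable:
  assumes "gaussian_rv M X"
  shows "X \<in> borel_measurable M" "integrable M (\<lambda>\<omega>. (X \<omega>)\<^sup>2)" "integrable M X"
proof -
  show X[measurable]: "X \<in> borel_measurable M" using assms by (simp add: gaussian_rv_def)
  show sq: "integrable M (\<lambda>\<omega>. (X \<omega>)\<^sup>2)"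
    using assms unfolding gaussian_rv_def
  proof (elim conjE disjE exE)
    fix \<mu> \<sigma> :: real
    assume \<sigma>: "\<sigma> > 0" and D: "distributed M lborel X (\<lambda>x. ennreal (normal_density \<mu> \<sigma> x))"
    have "integrable M (\<lambda>\<omega>. (X \<omega> - \<mu>) ^ k)" for k
      using distributed_integrable[OF D, of "\<lambda>x. (x - \<mu>) ^ k"] integrable_normal_moment[OF \<sigma>, of \<mu> k]
      by simp
    from this[of 1] this[of 2]
    have "integrable M (\<lambda>\<omega>. (X \<omega> - \<mu>)\<^sup>2 + 2 * \<mu> * (X \<omega> - \<mu>) ^ 1 + \<mu>\<^sup>2)"
      by (intro Bochner_Integration.integrable_add integrable_mult_right) auto
    then show ?thesis by (simp add: power2_eq_square algebra_simps)
  next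
    fix \<mu> assume "AE \<omega> in M. X \<omega> = \<mu>"
    then have "AE \<omega> in M. (X \<omega>)\<^sup>2 = \<mu>\<^sup>2" by auto
    then show ?thesis
      by (subst integrable_cong_AE[where g = "\<lambda>_. \<mu>\<^sup>2"]) auto
  qed
  show "integrable M X" using sq by (rule square_integrable_imp_integrable[OF X])
qed

lemma (in prob_space) integrable_mult_square_integrable:
  fixes X Y :: "'a \<Rightarrow> real"
  assumes [measurable]: "X \<in> borel_measurable M" "Y \<in> borel_measurable M"
    and "integrable M (\<lambda>\<omega>. (X \<omega>)\<^sup>2)" "integrable M (\<lambda>\<omega>. (Y \<omega>)\<^sup>2)"
  shows "integrable M (\<lambda>\<omega>. X \<omega> * Y \<omega>)"
proof (rule Bochner_Integration.integrable_bound)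
  show "integrable M (\<lambda>\<omega>. (X \<omega>)\<^sup>2 + (Y \<omega>)\<^sup>2)" using assms by auto
  have "\<bar>x * y\<bar> \<le> x\<^sup>2 + y\<^sup>2" for x y :: real
  proof -
    have "0 \<le> \<bar>x\<bar> * \<bar>y\<bar>" by simp
    then show ?thesis using sum_squares_bound[of "\<bar>x\<bar>" "\<bar>y\<bar>"] unfolding abs_mult power2_abs by linarith
  qed
  then show "AE \<omega> in M. norm (X \<omega> * Y \<omega>) \<le> norm ((X \<omega>)\<^sup>2 + (Y \<omega>)\<^sup>2)" by simp
qed simp

lemma (in prob_space) gaussian_rv_char:
  assumes X: "gaussian_rv M X" and mean: "expectation X = 0"
  shows "(\<integral>\<omega>. iexp (X \<omega>) \<partial>M) = exp (- (expectation (\<lambda>\<omega>. (X \<omega>)\<^sup>2)) / 2)"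
  using X unfolding gaussian_rv_def
proof (elim conjE disjE exE)
  fix \<mu> \<sigma> :: real
  assume \<sigma>: "\<sigma> > 0" and D: "distributed M lborel X (\<lambda>x. ennreal (normal_density \<mu> \<sigma> x))"
    and [measurable]: "X \<in> borel_measurable M"
  have "\<mu> = 0" using normal_distributed_expectation[OF \<sigma> D] mean by simp
  have var: "expectation (\<lambda>\<omega>. (X \<omega>)\<^sup>2) = \<sigma>\<^sup>2" using normal_distributed_variance[OF \<sigma> D] mean by simp
  have "distributed M lborel (\<lambda>\<omega>. X \<omega> / \<sigma>) std_normal_density"
    using D normal_standard_normal_convert[OF \<sigma>, of X \<mu>] \<open>\<mu> = 0\<close> by simp
  then have "distr M lborel (\<lambda>\<omega>. X \<omega> / \<sigma>) = std_normal_distribution"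
    by (simp add: distributed_def)
  then have "char (distr M lborel (\<lambda>\<omega>. X \<omega> / \<sigma>)) \<sigma> = complex_of_real (exp (- (\<sigma>^2) / 2))"
    by (simp add: char_std_normal_distribution)
  moreover have "char (distr M lborel (\<lambda>\<omega>. X \<omega> / \<sigma>)) \<sigma> = (\<integral>\<omega>. iexp (\<sigma> * (X \<omega> / \<sigma>)) \<partial>M)"
    unfolding char_def by (rule integral_distr) auto
  moreover have "\<sigma> * (X \<omega> / \<sigma>) = X \<omega>" for \<omega> using \<sigma> by simp
  ultimately show ?thesis using var by (simp only:)
next
  fix \<mu> assume c: "AE \<omega> in M. X \<omega> = \<mu>" and [measurable]: "X \<in> borel_measurable M"
  have "expectation X = (\<integral>\<omega>. \<mu> \<partial>M)" using c by (intro integral_cong_AE) auto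
  then have "\<mu> = 0" using mean by (simp add: prob_space)
  then have c: "AE \<omega> in M. X \<omega> = 0" using c by simp
  have "(\<integral>\<omega>. iexp (X \<omega>) \<partial>M) = (\<integral>\<omega>. 1 \<partial>M)" using c by (intro integral_cong_AE) auto
  moreover have "expectation (\<lambda>\<omega>. (X \<omega>)\<^sup>2) = (\<integral>\<omega>. 0 \<partial>M)" using c by (intro integral_cong_AE) auto
  ultimately show ?thesis by (simp add: prob_space)
qed

text \<open>With \<open>a = E[D\<^sup>2]\<close> and \<open>b = E[G\<^sup>2]\<close>, the function \<open>u \<mapsto> E[iexp (u * D + G)]\<close> equals
  \<open>exp (- (u\<^sup>2 * a + b) / 2)\<close>, whose derivative at \<open>0\<close> is zero. Differentiating under the
  expectation, with \<open>\<bar>D\<bar>\<close> dominating the difference quotients, that derivative is also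
  \<open>\<i> * E[D * iexp G]\<close>.\<close>

lemma (in prob_space) gaussian_uncorrelated_iexp:
  assumes gauss: "\<And>u. gaussian_rv M (\<lambda>\<omega>. u * D \<omega> + G \<omega>)"
    and D: "gaussian_rv M D"
    and mean: "expectation D = 0" "expectation G = 0"
    and uncorr: "expectation (\<lambda>\<omega>. D \<omega> * G \<omega>) = 0"
  shows "(\<integral>\<omega>. complex_of_real (D \<omega>) * iexp (G \<omega>) \<partial>M) = 0"
proof -
  have G: "gaussian_rv M G" using gauss[of 0] by simp
  note intD[measurable] = gaussian_rv_integrable[OF D]
  note intG[measurable] = gaussian_rv_integrable[OF G]
  have intDG: "integrable M (\<lambda>\<omega>. D \<omega> * G \<omega>)"
    using intD intG by (intro integrable_mult_square_integrable)
  define a where "a = expectation (\<lambda>\<omega>. (D \<omega>)\<^sup>2)"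
  define b where "b = expectation (\<lambda>\<omega>. (G \<omega>)\<^sup>2)"
  define f where "f u = exp (- (u\<^sup>2 * a + b) / 2)" for u :: real
  define h where "h n = inverse (real (Suc n))" for n
  have char: "(\<integral>\<omega>. iexp (u * D \<omega> + G \<omega>) \<partial>M) = complex_of_real (f u)" for u
  proof -
    have "expectation (\<lambda>\<omega>. u * D \<omega> + G \<omega>) = 0" using intD intG mean by simp
    moreover have "expectation (\<lambda>\<omega>. (u * D \<omega> + G \<omega>)\<^sup>2) = u\<^sup>2 * a + b"
    proof -
      have "expectation (\<lambda>\<omega>. (u * D \<omega> + G \<omega>)\<^sup>2) =
          expectation (\<lambda>\<omega>. u\<^sup>2 * (D \<omega>)\<^sup>2 + 2 * u * (D \<omega> * G \<omega>) + (G \<omega>)\<^sup>2)"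
        by (rule Bochner_Integration.integral_cong) (auto simp: power2_eq_square algebra_simps)
      then show ?thesis using intD intG intDG uncorr by (simp add: a_def b_def)
    qed
    ultimately show ?thesis using gaussian_rv_char[OF gauss[of u]] by (simp add: f_def)
  qed
  have h0: "h n \<noteq> 0" "h n > 0" for n by (auto simp: h_def)
  have h: "filterlim h (at 0) sequentially"
    unfolding filterlim_at h_def using LIMSEQ_inverse_real_of_nat by auto
  \<comment> \<open>the integrand of the difference quotient at \<open>0\<close> with step \<open>h n\<close>\<close>
  define s where "s n \<omega> = (iexp (h n * D \<omega>) - 1) / complex_of_real (h n) * iexp (G \<omega>)" for n \<omega>
  have "(\<lambda>n. \<integral>\<omega>. s n \<omega> \<partial>M) \<longlonglongrightarrow> (\<integral>\<omega>. \<i> * (complex_of_real (D \<omega>) * iexp (G \<omega>)) \<partial>M)"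
  proof (rule integral_dominated_convergence[where w = "\<lambda>\<omega>. \<bar>D \<omega>\<bar>"])
    show "integrable M (\<lambda>\<omega>. \<bar>D \<omega>\<bar>)" using intD by simp
    show "AE \<omega> in M. (\<lambda>n. s n \<omega>) \<longlonglongrightarrow> \<i> * (complex_of_real (D \<omega>) * iexp (G \<omega>))"
    proof (rule AE_I2)
      fix \<omega>
      have "((\<lambda>z. exp (\<i> * (z * complex_of_real (D \<omega>)))) has_field_derivative \<i> * D \<omega>) (at 0)"
        by (auto intro!: derivative_eq_intros)
      then have "((\<lambda>z. (exp (\<i> * (z * complex_of_real (D \<omega>))) - 1) / z) \<longlongrightarrow> \<i> * D \<omega>) (at 0)"
        by (simp add: DERIV_def)
      moreover have "filterlim (\<lambda>n. complex_of_real (h n)) (at 0) sequentially"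
        using h h0 unfolding filterlim_at by (auto intro!: tendsto_eq_intros)
      ultimately have "(\<lambda>n. (exp (\<i> * (complex_of_real (h n) * complex_of_real (D \<omega>))) - 1) / complex_of_real (h n)) \<longlonglongrightarrow> \<i> * D \<omega>"
        by (rule filterlim_compose)
      then have "(\<lambda>n. (iexp (h n * D \<omega>) - 1) / complex_of_real (h n) * iexp (G \<omega>)) \<longlonglongrightarrow> (\<i> * D \<omega>) * iexp (G \<omega>)"
        by (intro tendsto_mult) auto
      then show "(\<lambda>n. s n \<omega>) \<longlonglongrightarrow> \<i> * (complex_of_real (D \<omega>) * iexp (G \<omega>))"
        by (simp add: s_def mult.assoc)
    qed
    show "AE \<omega> in M. norm (s n \<omega>) \<le> \<bar>D \<omega>\<bar>" for n
    proof (rule AE_I2)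
      fix \<omega>
      have "cmod (iexp (h n * D \<omega>) - 1) \<le> h n * \<bar>D \<omega>\<bar>"
        using iexp_approx1[of "h n * D \<omega>" 0] h0(2)[of n] by (simp add: abs_mult)
      moreover have "norm (s n \<omega>) = cmod (iexp (h n * D \<omega>) - 1) / h n"
        using h0(2)[of n] by (simp add: s_def norm_mult norm_divide)
      ultimately show "norm (s n \<omega>) \<le> \<bar>D \<omega>\<bar>"
        using h0(2)[of n] by (simp only: pos_divide_le_eq mult.commute)
    qed
    show "s n \<in> borel_measurable M" for n unfolding s_def[abs_def] by measurable
  qed measurable
  moreover have "(\<lambda>n. \<integral>\<omega>. s n \<omega> \<partial>M) \<longlonglongrightarrow> 0"
  proof -
    have int: "integrable M (\<lambda>\<omega>. iexp (u * D \<omega> + G \<omega>))" for u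
      using integrable_real_iexp[of "\<lambda>_. 1" "\<lambda>\<omega>. u * D \<omega> + G \<omega>"] by simp
    have "(\<integral>\<omega>. s n \<omega> \<partial>M) = complex_of_real ((f (h n) - f 0) / h n)" for n
    proof -
      have "s n \<omega> = (iexp (h n * D \<omega> + G \<omega>) - iexp (0 * D \<omega> + G \<omega>)) / complex_of_real (h n)" for \<omega>
        by (simp add: s_def exp_add distrib_left algebra_simps)
      then have "(\<integral>\<omega>. s n \<omega> \<partial>M) =
          ((\<integral>\<omega>. iexp (h n * D \<omega> + G \<omega>) \<partial>M) - (\<integral>\<omega>. iexp (0 * D \<omega> + G \<omega>) \<partial>M)) / complex_of_real (h n)"
        by (simp only: integral_divide_zero Bochner_Integration.integral_diff[OF int int])
      then show ?thesis by (simp only: char of_real_diff of_real_divide)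
    qed
    moreover have "((\<lambda>u. (f u - f 0) / u) \<longlongrightarrow> 0) (at 0)"
    proof -
      have "(f has_field_derivative 0) (at 0)"
        unfolding f_def by (auto intro!: derivative_eq_intros)
      then show ?thesis by (simp add: DERIV_def)
    qed
    then have "(\<lambda>n. complex_of_real ((f (h n) - f 0) / h n)) \<longlonglongrightarrow> complex_of_real 0"
      by (intro tendsto_of_real filterlim_compose[OF _ h])
    ultimately show ?thesis by simp
  qed
  ultimately have "(\<integral>\<omega>. \<i> * (complex_of_real (D \<omega>) * iexp (G \<omega>)) \<partial>M) = 0"
    by (rule LIMSEQ_unique)
  then show ?thesis by simp
qed

lemma (in prob_space) gaussian_uncorrelated_integral_zero:
  fixes X :: "'i \<Rightarrow> 'a \<Rightarrow> real"
  assumes K: "finite K"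
    and gauss: "\<And>u v. gaussian_rv M (\<lambda>\<omega>. u * D \<omega> + (\<Sum>k\<in>K. v k * X k \<omega>))"
    and X: "\<And>k. k \<in> K \<Longrightarrow> gaussian_rv M (X k)"
    and mean: "expectation D = 0" "\<And>k. k \<in> K \<Longrightarrow> expectation (X k) = 0"
    and uncorr: "\<And>k. k \<in> K \<Longrightarrow> expectation (\<lambda>\<omega>. D \<omega> * X k \<omega>) = 0"
    and A: "A \<in> sets (generated_sigma M K X)"
  shows "(\<integral>\<omega>. indicator A \<omega> * D \<omega> \<partial>M) = 0"
proof (rule weight_zero_on_generated_sigma[OF K _ _ _ A])
  have D: "gaussian_rv M D" using gauss[of 1 "\<lambda>_. 0"] by simp
  show "integrable M D" using gaussian_rv_integrable[OF D] by simp
  show "X k \<in> borel_measurable M" if "k \<in> K" for k using gaussian_rv_integrable[OF X[OF that]] by simp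
  fix v
  show "(\<integral>\<omega>. complex_of_real (D \<omega>) * iexp (\<Sum>k\<in>K. v k * X k \<omega>) \<partial>M) = 0"
  proof (rule gaussian_uncorrelated_iexp[OF gauss D mean(1)])
    show "expectation (\<lambda>\<omega>. \<Sum>k\<in>K. v k * X k \<omega>) = 0"
      using X mean(2) gaussian_rv_integrable by (simp add: Bochner_Integration.integral_sum)
    have i: "integrable M (\<lambda>\<omega>. D \<omega> * X k \<omega>)" if "k \<in> K" for k
      using gaussian_rv_integrable[OF X[OF that]] gaussian_rv_integrable[OF D]
      by (intro integrable_mult_square_integrable)
    have "expectation (\<lambda>\<omega>. D \<omega> * (\<Sum>k\<in>K. v k * X k \<omega>)) = expectation (\<lambda>\<omega>. \<Sum>k\<in>K. v k * (D \<omega> * X k \<omega>))"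
      by (simp add: sum_distrib_left mult_ac)
    also have "\<dots> = 0" using i uncorr by (simp add: Bochner_Integration.integral_sum)
    finally show "expectation (\<lambda>\<omega>. D \<omega> * (\<Sum>k\<in>K. v k * X k \<omega>)) = 0" .
  qed
qed

section \<open>Time integrals of continuous processes\<close>

text \<open>By path continuity the process is the pointwise limit of its values at the times
  \<open>\<lfloor>(n + 1) * s\<rfloor> / (n + 1)\<close>, which take countably many values.\<close>

lemma borel_measurable_continuous_process:
  fixes X :: "real \<Rightarrow> 'a \<Rightarrow> real"
  assumes X: "\<And>s. X s \<in> borel_measurable M"
    and cont: "\<And>\<omega>. \<omega> \<in> space M \<Longrightarrow> continuous_on UNIV (\<lambda>s. X s \<omega>)"
  shows "(\<lambda>p. X (fst p) (snd p)) \<in> borel_measurable (borel \<Otimes>\<^sub>M M)"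
proof -
  define r where "r n s = of_int \<lfloor>real (Suc n) * s\<rfloor> / real (Suc n)" for n and s :: real
  show ?thesis
  proof (rule borel_measurable_LIMSEQ_real)
    fix n
    note [measurable] = X
    have "(\<lambda>p. X (of_int k / real (Suc n)) (snd p)) \<in> borel_measurable (borel \<Otimes>\<^sub>M M)" for k :: int
      by measurable
    moreover have "(\<lambda>p. \<lfloor>real (Suc n) * fst p\<rfloor>) \<in> measurable (borel \<Otimes>\<^sub>M M) (count_space UNIV)"
      by measurable
    ultimately show "(\<lambda>p. X (r n (fst p)) (snd p)) \<in> borel_measurable (borel \<Otimes>\<^sub>M M)"
      unfolding r_def by (rule measurable_compose_countable)
  next
    fix p :: "real \<times> 'a" assume "p \<in> space (borel \<Otimes>\<^sub>M M)"
    then have "isCont (\<lambda>s. X s (snd p)) (fst p)"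
      using cont[of "snd p"] by (auto simp: space_pair_measure continuous_on_eq_continuous_at)
    moreover have "(\<lambda>n. r n (fst p)) \<longlonglongrightarrow> fst p"
    proof (rule tendsto_sandwich)
      show "(\<lambda>n. fst p - 1 / real (Suc n)) \<longlonglongrightarrow> fst p"
        by (rule tendsto_eq_rhs[OF tendsto_diff[OF tendsto_const LIMSEQ_Suc[OF lim_1_over_n]]]) simp
      show "\<forall>\<^sub>F n in sequentially. fst p - 1 / real (Suc n) \<le> r n (fst p)"
      proof (intro always_eventually allI)
        fix n
        have "real (Suc n) * fst p - 1 \<le> of_int \<lfloor>real (Suc n) * fst p\<rfloor>" by linarith
        then have "(real (Suc n) * fst p - 1) / real (Suc n) \<le> r n (fst p)"
          unfolding r_def by (rule divide_right_mono) simp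
        then show "fst p - 1 / real (Suc n) \<le> r n (fst p)" by (simp add: diff_divide_distrib)
      qed
      show "\<forall>\<^sub>F n in sequentially. r n (fst p) \<le> fst p"
      proof (intro always_eventually allI)
        fix n
        have "of_int \<lfloor>real (Suc n) * fst p\<rfloor> \<le> real (Suc n) * fst p" by linarith
        then have "r n (fst p) \<le> (real (Suc n) * fst p) / real (Suc n)"
          unfolding r_def by (rule divide_right_mono) simp
        then show "r n (fst p) \<le> fst p" by simp
      qed
    qed simp
    ultimately show "(\<lambda>n. X (r n (fst p)) (snd p)) \<longlonglongrightarrow> X (fst p) (snd p)"
      by (rule isCont_tendsto_compose)
  qed
qed

lemma (in prob_space) set_integral_process_Fubini:
  fixes X :: "real \<Rightarrow> 'a \<Rightarrow> real" and e :: "real \<Rightarrow> real"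
  assumes X: "\<And>s. s \<in> {a..b} \<Longrightarrow> integrable M (X s)"
    and cont: "\<And>\<omega>. \<omega> \<in> space M \<Longrightarrow> continuous_on {a..b} (\<lambda>s. X s \<omega>)"
    and bound: "\<And>s. s \<in> {a..b} \<Longrightarrow> expectation (\<lambda>\<omega>. \<bar>X s \<omega>\<bar>) \<le> K"
    and e: "continuous_on {a..b} e" and ab: "a \<le> b"
  shows "integrable M (\<lambda>\<omega>. LINT s:{a..b}|lborel. X s \<omega> * e s)" (is ?int)
    and "\<And>A. A \<in> sets M \<Longrightarrow>
      (\<integral>\<omega>. indicator A \<omega> * (LINT s:{a..b}|lborel. X s \<omega> * e s) \<partial>M) =
      (LINT s:{a..b}|lborel. (\<integral>\<omega>. indicator A \<omega> * X s \<omega> \<partial>M) * e s)"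
proof -
  interpret P: pair_sigma_finite lborel M by standard
  \<comment> \<open>freezing the process outside the interval makes its paths continuous on the whole line\<close>
  define c where "c s = max a (min b s)" for s
  have c: "c s \<in> {a..b}" "s \<in> {a..b} \<Longrightarrow> c s = s" for s using ab by (auto simp: c_def)
  have ccont: "continuous_on UNIV c" unfolding c_def by (intro continuous_intros)
  have clamp: "continuous_on UNIV (\<lambda>s. f (c s))" if "continuous_on {a..b} f" for f :: "real \<Rightarrow> real"
    by (rule continuous_on_compose2[OF that ccont]) (use c(1) in auto)
  have [measurable]: "(\<lambda>p. X (c (fst p)) (snd p)) \<in> borel_measurable (lborel \<Otimes>\<^sub>M M)"
  proof -
    have "(\<lambda>p. X (c (fst p)) (snd p)) \<in> borel_measurable (borel \<Otimes>\<^sub>M M)"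
      using X[OF c(1)] clamp[OF cont] by (intro borel_measurable_continuous_process) auto
    then show ?thesis by (simp cong: measurable_cong_sets sets_pair_measure_cong)
  qed
  have ec[measurable]: "(\<lambda>s. e (c s)) \<in> borel_measurable borel"
    using clamp[OF e] by (rule borel_measurable_continuous_onI)
  have "bounded (e ` {a..b})" using e by (intro compact_imp_bounded compact_continuous_image) auto
  then obtain C where C: "\<And>s. s \<in> {a..b} \<Longrightarrow> \<bar>e s\<bar> \<le> C" unfolding bounded_iff real_norm_def by blast
  define h where "h A s \<omega> = indicator {a..b} s * (indicator A \<omega> * X (c s) \<omega> * e (c s))"
    for A :: "'a set" and s \<omega>
  have h_s: "(LINT s|lborel. h A s \<omega>) = indicator A \<omega> * (LINT s:{a..b}|lborel. X s \<omega> * e s)" for A \<omega>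
  proof -
    have "h A s \<omega> = indicator A \<omega> * (indicator {a..b} s *\<^sub>R (X s \<omega> * e s))" for s
      by (auto simp: h_def indicator_def c)
    then show ?thesis by (simp add: set_lebesgue_integral_def)
  qed
  have h_\<omega>: "(\<integral>\<omega>. h A s \<omega> \<partial>M) = indicator {a..b} s *\<^sub>R ((\<integral>\<omega>. indicator A \<omega> * X s \<omega> \<partial>M) * e s)" for A s
    by (cases "s \<in> {a..b}") (simp_all add: h_def c)
  have hint: "integrable (lborel \<Otimes>\<^sub>M M) (case_prod (h A))" if A[measurable]: "A \<in> sets M" for A
  proof -
    have hm[measurable]: "case_prod (h A) \<in> borel_measurable (lborel \<Otimes>\<^sub>M M)"
      unfolding h_def split_beta' by measurable
    have hsm: "integrable M (h A s)" for s
    proof -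
      have "integrable M (\<lambda>\<omega>. indicator A \<omega> * X (c s) \<omega>)"
        using integrable_mult_indicator[OF A X[OF c(1)[of s]]] by simp
      then show ?thesis unfolding h_def by (intro integrable_mult_right integrable_mult_left) auto
    qed
    show ?thesis
    proof (rule P.Fubini_integrable)
      show "case_prod (h A) \<in> borel_measurable (lborel \<Otimes>\<^sub>M M)" by simp
      show "AE s in lborel. integrable M (\<lambda>\<omega>. case_prod (h A) (s, \<omega>))" using hsm by simp
      show "integrable lborel (\<lambda>s. \<integral>\<omega>. norm (case_prod (h A) (s, \<omega>)) \<partial>M)"
      proof (rule integrableI_bounded_set[where A = "{a..b}" and B = "K * C"])
        have "norm (\<integral>\<omega>. norm (h A s \<omega>) \<partial>M) \<le> K * C" if s: "s \<in> {a..b}" for s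
        proof -
          have C0: "0 \<le> C" using C[OF s] by linarith
          have "(\<integral>\<omega>. norm (h A s \<omega>) \<partial>M) \<le> (\<integral>\<omega>. \<bar>X s \<omega>\<bar> * C \<partial>M)"
          proof (rule integral_mono)
            show "integrable M (\<lambda>\<omega>. norm (h A s \<omega>))" using hsm by (rule integrable_norm)
            show "integrable M (\<lambda>\<omega>. \<bar>X s \<omega>\<bar> * C)" using X[OF s] by auto
            show "norm (h A s \<omega>) \<le> \<bar>X s \<omega>\<bar> * C" for \<omega>
              using C[OF s] C0 s by (auto simp: h_def c abs_mult indicator_def intro!: mult_left_mono)
          qed
          also have "\<dots> \<le> K * C" using bound[OF s] C0 by (auto intro!: mult_right_mono)
          finally show ?thesis by simp
        qed
        then show "AE s in lborel. s \<in> {a..b} \<longrightarrow> norm (\<integral>\<omega>. norm (case_prod (h A) (s, \<omega>)) \<partial>M) \<le> K * C"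
          by simp
        show "AE s in lborel. s \<notin> {a..b} \<longrightarrow> (\<integral>\<omega>. norm (case_prod (h A) (s, \<omega>)) \<partial>M) = 0"
          by (simp add: h_def)
        show "emeasure lborel {a..b} < \<infinity>" using ab by simp
      qed measurable
    qed
  qed
  have "integrable M (\<lambda>\<omega>. LINT s|lborel. h (space M) s \<omega>)"
    using P.integrable_snd[OF hint[of "space M"]] by simp
  then show ?int
    unfolding h_s by (rule Bochner_Integration.integrable_cong[THEN iffD1, rotated 2]) auto
  show "(\<integral>\<omega>. indicator A \<omega> * (LINT s:{a..b}|lborel. X s \<omega> * e s) \<partial>M) =
      (LINT s:{a..b}|lborel. (\<integral>\<omega>. indicator A \<omega> * X s \<omega> \<partial>M) * e s)" if "A \<in> sets M" for A
    using P.Fubini_integral[OF hint[OF that]] unfolding h_s h_\<omega> by (simp add: set_lebesgue_integral_def)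
qed

lemma set_integral_chain:
  fixes f :: "real \<Rightarrow> real" and t :: "nat \<Rightarrow> real"
  assumes mono: "\<And>j. j < n \<Longrightarrow> t j \<le> t (j + 1)" and f: "continuous_on {t 0..t n} f"
  shows "(LINT s:{t 0..t n}|lborel. f s) = (\<Sum>j<n. LINT s:{t j..t (j + 1)}|lborel. f s)"
  using assms
proof (induction n)
  case 0
  show ?case using interval_integral_Icc[of "t 0" "t 0" f] by simp
next
  case (Suc n)
  have le0: "t 0 \<le> t m" if "m \<le> n" for m
    using that Suc.prems(1) by (induction m) (auto intro: order_trans)
  have le: "t 0 \<le> t n" "t n \<le> t (Suc n)" using le0 Suc.prems(1)[of n] by auto
  have "continuous_on {t 0..t n} f" using Suc.prems(2) by (rule continuous_on_subset) (use le in auto)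
  then have IH: "(LINT s:{t 0..t n}|lborel. f s) = (\<Sum>j<n. LINT s:{t j..t (j + 1)}|lborel. f s)"
    using Suc by auto
  have "(LBINT x=t 0..t n. f x) + (LBINT x=t n..t (Suc n). f x) = (LBINT x=t 0..t (Suc n). f x)"
    using interval_integrable_continuous_on[OF order_trans[OF le] Suc.prems(2)] le
    by (intro interval_integral_sum) (simp add: min_def max_def)
  then show ?case
    using le IH by (simp add: interval_integral_Icc)
qed

section \<open>The Brownian bridge between two observation times\<close>

text \<open>The definition of a Gaussian process speaks of sums over sets of times. Observation times may
  coincide, with each other or with the times in \<open>L\<close>, so their coefficients have to be
  collected time by time.\<close>

lemma gaussian_process_combination:
  assumes gp: "gaussian_process M I X" and K: "finite K" "\<tau> ` K \<subseteq> I" and L: "finite L" "L \<subseteq> I"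
  shows "gaussian_rv M (\<lambda>\<omega>. (\<Sum>p\<in>L. c p * X p \<omega>) + (\<Sum>k\<in>K. v k * X (\<tau> k) \<omega>))"
proof -
  let ?J = "L \<union> \<tau> ` K"
  let ?d = "\<lambda>p. (if p \<in> L then c p else 0) + (\<Sum>k\<in>K. if \<tau> k = p then v k else 0)"
  have "gaussian_rv M (\<lambda>\<omega>. \<Sum>p\<in>?J. ?d p * X p \<omega>)"
    by (rule gp[unfolded gaussian_process_def, rule_format]) (use K L in auto)
  moreover have "(\<Sum>p\<in>?J. ?d p * X p \<omega>) = (\<Sum>p\<in>L. c p * X p \<omega>) + (\<Sum>k\<in>K. v k * X (\<tau> k) \<omega>)" for \<omega>
  proof -
    have "?d p * X p \<omega> = (if p \<in> L then c p * X p \<omega> else 0) + (\<Sum>k\<in>K. if \<tau> k = p then v k * X p \<omega> else 0)" for p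
    proof -
      have "(\<Sum>k\<in>K. if \<tau> k = p then v k else 0) * X p \<omega> = (\<Sum>k\<in>K. if \<tau> k = p then v k * X p \<omega> else 0)"
        unfolding sum_distrib_right by (rule sum.cong) auto
      then show ?thesis by (simp add: distrib_right)
    qed
    then have "(\<Sum>p\<in>?J. ?d p * X p \<omega>) = (\<Sum>p\<in>?J. if p \<in> L then c p * X p \<omega> else 0) +
        (\<Sum>p\<in>?J. \<Sum>k\<in>K. if \<tau> k = p then v k * X p \<omega> else 0)"
      by (simp only: sum.distrib)
    also have "(\<Sum>p\<in>?J. if p \<in> L then c p * X p \<omega> else 0) = (\<Sum>p\<in>L. c p * X p \<omega>)"
      by (rule sum.mono_neutral_cong_right) (use K L in auto)
    also have "(\<Sum>p\<in>?J. \<Sum>k\<in>K. if \<tau> k = p then v k * X p \<omega> else 0) =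
        (\<Sum>k\<in>K. \<Sum>p\<in>?J. if \<tau> k = p then v k * X p \<omega> else 0)"
      by (rule sum.swap)
    also have "\<dots> = (\<Sum>k\<in>K. v k * X (\<tau> k) \<omega>)"
    proof (rule sum.cong)
      fix k assume "k \<in> K"
      then show "(\<Sum>p\<in>?J. if \<tau> k = p then v k * X p \<omega> else 0) = v k * X (\<tau> k) \<omega>"
        by (subst sum.delta') (use K L in auto)
    qed simp
    finally show ?thesis .
  qed
  ultimately show ?thesis by simp
qed

lemma (in prob_space) brownian_bridge_moments:
  assumes B: "brownian_bridge M T B" and s: "s \<in> {0..T}"
  shows "gaussian_rv M (B s)" "integrable M (B s)" "expectation (B s) = 0"
    and "r \<in> {0..T} \<Longrightarrow> integrable M (\<lambda>\<omega>. B s \<omega> * B r \<omega>)"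
    and "r \<in> {0..T} \<Longrightarrow> expectation (\<lambda>\<omega>. B s \<omega> * B r \<omega>) = min s r - s * r / T"
    and "expectation (\<lambda>\<omega>. \<bar>B s \<omega>\<bar>) \<le> 1 + T"
proof -
  have g: "gaussian_rv M (B p)" if "p \<in> {0..T}" for p
  proof -
    have "gaussian_rv M (\<lambda>\<omega>. \<Sum>q\<in>{p}. 1 * B q \<omega>)"
      by (rule B[unfolded brownian_bridge_def gaussian_process_def, THEN conjunct1, rule_format])
         (use that in auto)
    then show ?thesis by simp
  qed
  show "gaussian_rv M (B s)" using g s by blast
  note int = gaussian_rv_integrable[OF g]
  show ints: "integrable M (B s)" using int s by blast
  have mean: "expectation (B p) = 0" if "p \<in> {0..T}" for p
    using B that unfolding brownian_bridge_def by blast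
  then show "expectation (B s) = 0" using s by blast
  show "integrable M (\<lambda>\<omega>. B s \<omega> * B r \<omega>)" if "r \<in> {0..T}" for r
    using int s that by (intro integrable_mult_square_integrable) auto
  have cov: "expectation (\<lambda>\<omega>. B s \<omega> * B r \<omega>) = min s r - s * r / T" if "r \<in> {0..T}" for r
  proof -
    have "covariance M (B s) (B r) = min s r - s * r / T"
      using B s that unfolding brownian_bridge_def by blast
    then show ?thesis unfolding covariance_def using mean s that by simp
  qed
  then show "r \<in> {0..T} \<Longrightarrow> expectation (\<lambda>\<omega>. B s \<omega> * B r \<omega>) = min s r - s * r / T" .
  have "expectation (\<lambda>\<omega>. \<bar>B s \<omega>\<bar>) \<le> expectation (\<lambda>\<omega>. 1 + (B s \<omega>)\<^sup>2)"
  proof (rule integral_mono)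
    show "\<bar>B s \<omega>\<bar> \<le> 1 + (B s \<omega>)\<^sup>2" for \<omega>
    proof -
      have "0 \<le> (\<bar>B s \<omega>\<bar> - 1)\<^sup>2" by simp
      then show ?thesis by (simp add: power2_diff)
    qed
  qed (use int s in auto)
  also have "\<dots> = 1 + expectation (\<lambda>\<omega>. (B s \<omega>)\<^sup>2)" using int s by (simp add: prob_space)
  also have "expectation (\<lambda>\<omega>. (B s \<omega>)\<^sup>2) = s - s * s / T"
    using cov[OF s] by (simp add: power2_eq_square)
  also have "\<dots> \<le> T" using s by (simp add: field_simps add_increasing2)
  finally show "expectation (\<lambda>\<omega>. \<bar>B s \<omega>\<bar>) \<le> 1 + T" by simp
qed

text \<open>This is \<open>E[B s | \<F>]\<close> in integrated form. The interpolation error \<open>D\<close>, scaled by \<open>b - a\<close>,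
  has covariance \<open>(b - a) * \<kappa> s - (b - s) * \<kappa> a - (s - a) * \<kappa> b\<close> with \<open>B r\<close>, where
  \<open>\<kappa> s = min s r - s * r / T\<close>; this is zero because \<open>\<kappa>\<close> is affine on \<open>[a, b]\<close> unless
  \<open>a < r < b\<close>.\<close>

lemma (in prob_space) brownian_bridge_interpolation:
  assumes B: "brownian_bridge M T B" and K: "finite K" "\<tau> ` K \<subseteq> {0..T}"
    and ab: "0 \<le> a" "a < b" "b \<le> T" and gap: "\<And>k. k \<in> K \<Longrightarrow> \<tau> k \<le> a \<or> b \<le> \<tau> k"
    and s: "s \<in> {a..b}"
    and A: "A \<in> sets (generated_sigma M K (\<lambda>k. B (\<tau> k)))"
  shows "(\<integral>\<omega>. indicator A \<omega> * B s \<omega> \<partial>M) =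
    ((b - s) * (\<integral>\<omega>. indicator A \<omega> * B a \<omega> \<partial>M) + (s - a) * (\<integral>\<omega>. indicator A \<omega> * B b \<omega> \<partial>M)) / (b - a)"
proof -
  have T: "T > 0" using ab by linarith
  have in_T: "s \<in> {0..T}" "a \<in> {0..T}" "b \<in> {0..T}" using s ab by auto
  note mom = brownian_bridge_moments[OF B]
  define D where "D \<omega> = (b - a) * B s \<omega> - (b - s) * B a \<omega> - (s - a) * B b \<omega>" for \<omega>
  have zero: "(\<integral>\<omega>. indicator A \<omega> * D \<omega> \<partial>M) = 0"
  proof (rule gaussian_uncorrelated_integral_zero[OF K(1) _ _ _ _ _ A])
    fix u v
    have "gaussian_process M {0..T} B" using B by (simp add: brownian_bridge_def)
    define c where "c p = u * ((b - a) * of_bool (p = s) - (b - s) * of_bool (p = a) - (s - a) * of_bool (p = b))" for p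
    have "(\<Sum>p\<in>{s, a, b}. c p * B p \<omega>) = u * D \<omega>" for \<omega>
    proof -
      have "(\<Sum>p\<in>{s, a, b}. c p * B p \<omega>) =
         (\<Sum>p\<in>{s, a, b}. if p = s then u * (b - a) * B p \<omega> else 0) +
         (\<Sum>p\<in>{s, a, b}. if p = a then - u * (b - s) * B p \<omega> else 0) +
         (\<Sum>p\<in>{s, a, b}. if p = b then - u * (s - a) * B p \<omega> else 0)"
        unfolding sum.distrib[symmetric] by (intro sum.cong) (auto simp: c_def algebra_simps)
      also have "\<dots> = u * D \<omega>"
        by (subst (1 2 3) sum.delta) (auto simp: D_def algebra_simps)
      finally show ?thesis .
    qed
    then show "gaussian_rv M (\<lambda>\<omega>. u * D \<omega> + (\<Sum>k\<in>K. v k * B (\<tau> k) \<omega>))"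
      using gaussian_process_combination[OF \<open>gaussian_process M {0..T} B\<close> K, of "{s, a, b}" c v] in_T by simp
  next
    show "expectation D = 0" unfolding D_def using mom in_T by simp
    fix k assume k: "k \<in> K"
    then have r: "\<tau> k \<in> {0..T}" using K by auto
    show "gaussian_rv M (B (\<tau> k))" "expectation (B (\<tau> k)) = 0" using mom r by auto
    have "expectation (\<lambda>\<omega>. D \<omega> * B (\<tau> k) \<omega>) =
      expectation (\<lambda>\<omega>. (b - a) * (B s \<omega> * B (\<tau> k) \<omega>) - (b - s) * (B a \<omega> * B (\<tau> k) \<omega>) - (s - a) * (B b \<omega> * B (\<tau> k) \<omega>))"
      by (simp add: D_def algebra_simps)
    also have "\<dots> = (b - a) * (min s (\<tau> k) - s * \<tau> k / T) - (b - s) * (min a (\<tau> k) - a * \<tau> k / T)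
        - (s - a) * (min b (\<tau> k) - b * \<tau> k / T)"
      using mom(4,5) in_T r by simp
    also have "\<dots> = 0"
      using gap[OF k]
    proof
      assume "\<tau> k \<le> a"
      then have "min s (\<tau> k) = \<tau> k" "min a (\<tau> k) = \<tau> k" "min b (\<tau> k) = \<tau> k" using s ab by auto
      then show ?thesis using T by (simp add: field_simps)
    next
      assume "b \<le> \<tau> k"
      then have "min s (\<tau> k) = s" "min a (\<tau> k) = a" "min b (\<tau> k) = b" using s ab by auto
      then show ?thesis using T by (simp add: field_simps)
    qed
    finally show "expectation (\<lambda>\<omega>. D \<omega> * B (\<tau> k) \<omega>) = 0" .
  qed
  have "A \<in> sets M"
  proof -
    have "B (\<tau> k) \<in> borel_measurable M" if "k \<in> K" for k
      using that mom(2)[of "\<tau> k"] K by auto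
    then have "subalgebra M (generated_sigma M K (\<lambda>k. B (\<tau> k)))"
      by (rule subalgebra_generated_sigma)
    then show ?thesis using A by (auto simp: subalgebra_def)
  qed
  then have i: "integrable M (\<lambda>\<omega>. indicator A \<omega> * B p \<omega>)" if "p \<in> {0..T}" for p
    using integrable_mult_indicator[OF _ mom(2)[OF that]] by simp
  have "(\<integral>\<omega>. indicator A \<omega> * D \<omega> \<partial>M) = (\<integral>\<omega>. (b - a) * (indicator A \<omega> * B s \<omega>)
      - (b - s) * (indicator A \<omega> * B a \<omega>) - (s - a) * (indicator A \<omega> * B b \<omega>) \<partial>M)"
    by (simp add: D_def algebra_simps)
  also have "\<dots> = (b - a) * (\<integral>\<omega>. indicator A \<omega> * B s \<omega> \<partial>M) - (b - s) * (\<integral>\<omega>. indicator A \<omega> * B a \<omega> \<partial>M)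
      - (s - a) * (\<integral>\<omega>. indicator A \<omega> * B b \<omega> \<partial>M)"
    using i in_T by simp
  finally show ?thesis using zero ab by (simp add: field_simps)
qed

section \<open>Integrating against the eigenfunction\<close>

lemma eB_derivatives:
  assumes "T > 0" "i \<ge> 1"
  shows "(eB T i has_real_derivative deriv (eB T i) x) (at x)"
    and "(deriv (eB T i) has_real_derivative - (eB T i x / lambdaB T i)) (at x)"
proof -
  have d: "(eB T i has_real_derivative sqrt (2 / T) * (cos (pi * real i * (x / T)) * (pi * real i / T))) (at x)" for x
    unfolding eB_def using assms by (auto intro!: derivative_eq_intros)
  then show "(eB T i has_real_derivative deriv (eB T i) x) (at x)"
    using DERIV_imp_deriv[OF d] by simp
  have "deriv (eB T i) = (\<lambda>x. sqrt (2 / T) * (cos (pi * real i * (x / T)) * (pi * real i / T)))"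
    by (rule ext) (rule DERIV_imp_deriv[OF d])
  moreover have "((\<lambda>x. sqrt (2 / T) * (cos (pi * real i * (x / T)) * (pi * real i / T))) has_real_derivative
      - (eB T i x / lambdaB T i)) (at x)"
    using assms by (auto intro!: derivative_eq_intros simp: eB_def lambdaB_def power2_eq_square)
  ultimately show "(deriv (eB T i) has_real_derivative - (eB T i x / lambdaB T i)) (at x)" by simp
qed

text \<open>The integrals over \<open>[a, b]\<close> of \<open>eB T i\<close> against the two affine functions with values
  \<open>(1, 0)\<close> and \<open>(0, 1)\<close> at \<open>(a, b)\<close>, respectively; degenerate subintervals contribute nothing.\<close>

definition left_weight :: "real \<Rightarrow> nat \<Rightarrow> real \<Rightarrow> real \<Rightarrow> real" where
  "left_weight T i a b =
     (if a < b then lambdaB T i * (deriv (eB T i) a - (eB T i b - eB T i a) / (b - a)) else 0)"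

definition right_weight :: "real \<Rightarrow> nat \<Rightarrow> real \<Rightarrow> real \<Rightarrow> real" where
  "right_weight T i a b =
     (if a < b then lambdaB T i * ((eB T i b - eB T i a) / (b - a) - deriv (eB T i) b) else 0)"

text \<open>Integration by parts, written as an antiderivative: replacing \<open>eB T i\<close> by
  \<open>- lambdaB T i * (eB T i)''\<close>, a product \<open>l * (eB T i)''\<close> with affine \<open>l\<close> of slope \<open>m\<close> is the
  derivative of \<open>l * (eB T i)' - m * eB T i\<close>.\<close>

lemma integral_linear_times_eB:
  assumes T: "T > 0" "i \<ge> 1" and ab: "a < b"
  shows "(LINT s:{a..b}|lborel. ((b - s) * U + (s - a) * V) / (b - a) * eB T i s) =
    left_weight T i a b * U + right_weight T i a b * V"
proof -
  let ?e = "eB T i" and ?e' = "deriv (eB T i)"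
  note d = eB_derivatives[OF T]
  have l: "lambdaB T i \<noteq> 0" using T by (simp add: lambdaB_def)
  define F where "F s = - lambdaB T i *
      (U * (?e' s * (b - s) + ?e s) + V * (?e' s * (s - a) - ?e s)) / (b - a)" for s
  have inner: "((\<lambda>s. U * (?e' s * (b - s) + ?e s) + V * (?e' s * (s - a) - ?e s)) has_real_derivative
      - (?e s / lambdaB T i) * ((b - s) * U + (s - a) * V)) (at s)" for s
    by (auto intro!: derivative_eq_intros d) (simp add: algebra_simps diff_divide_distrib add_divide_distrib)
  have F: "(F has_real_derivative ((b - s) * U + (s - a) * V) / (b - a) * ?e s) (at s)" for s
    unfolding F_def by (rule DERIV_cong[OF DERIV_cdivide[OF DERIV_cmult[OF inner]]]) (use l in simp)
  have econt: "continuous_on {a..b} ?e"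
    by (rule DERIV_continuous_on[OF DERIV_subset[OF d(1)]]) simp
  have "(LBINT s=a..b. ((b - s) * U + (s - a) * V) / (b - a) * ?e s) = F b - F a"
  proof (rule interval_integral_FTC_finite)
    show "continuous_on {min a b..max a b} (\<lambda>s. ((b - s) * U + (s - a) * V) / (b - a) * ?e s)"
      using ab econt by (auto intro!: continuous_intros)
    show "(F has_vector_derivative ((b - s) * U + (s - a) * V) / (b - a) * ?e s) (at s within {min a b..max a b})" for s
      using F[of s] by (auto simp: has_real_derivative_iff_has_vector_derivative intro: has_vector_derivative_at_within)
  qed
  also have "F b - F a = left_weight T i a b * U + right_weight T i a b * V"
    using ab by (simp add: F_def left_weight_def right_weight_def divide_simps) (simp add: algebra_simps)
  finally show ?thesis using ab by (simp add: interval_integral_Icc)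
qed

text \<open>Fubini's theorem moves the integral over the event inside the time integral, where
  \<open>B s\<close> may be replaced by its interpolation.\<close>

lemma (in prob_space) brownian_bridge_subinterval:
  assumes B: "brownian_bridge M T B" and T: "T > 0" "i \<ge> 1"
    and K: "finite K" "\<tau> ` K \<subseteq> {0..T}"
    and ab: "0 \<le> a" "a \<le> b" "b \<le> T" and gap: "\<And>k. k \<in> K \<Longrightarrow> \<tau> k \<le> a \<or> b \<le> \<tau> k"
  shows "integrable M (\<lambda>\<omega>. LINT s:{a..b}|lborel. B s \<omega> * eB T i s)" (is ?int)
    and "A \<in> sets (generated_sigma M K (\<lambda>k. B (\<tau> k))) \<Longrightarrow>
      (\<integral>\<omega>. indicator A \<omega> * (LINT s:{a..b}|lborel. B s \<omega> * eB T i s) \<partial>M) =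
      (\<integral>\<omega>. indicator A \<omega> * (left_weight T i a b * B a \<omega> + right_weight T i a b * B b \<omega>) \<partial>M)"
proof -
  note mom = brownian_bridge_moments[OF B]
  have cont: "continuous_on {a..b} (\<lambda>s. B s \<omega>)" if "\<omega> \<in> space M" for \<omega>
  proof (rule continuous_on_subset)
    show "continuous_on {0..T} (\<lambda>s. B s \<omega>)" using B that by (simp add: brownian_bridge_def)
  qed (use ab in auto)
  have econt: "continuous_on {a..b} (eB T i)"
    by (rule DERIV_continuous_on[OF DERIV_subset[OF eB_derivatives(1)[OF T]]]) simp
  have inT: "s \<in> {0..T}" if "s \<in> {a..b}" for s using that ab by auto
  note Fubini = set_integral_process_Fubini[where X = B and e = "eB T i" and a = a and b = b and K = "1 + T",
      OF mom(2)[OF inT] cont mom(6)[OF inT] econt ab(2)]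
  show ?int by (rule Fubini(1))
  assume A: "A \<in> sets (generated_sigma M K (\<lambda>k. B (\<tau> k)))"
  have AM: "A \<in> sets M"
  proof -
    have "B (\<tau> k) \<in> borel_measurable M" if "k \<in> K" for k
      using that mom(2)[of "\<tau> k"] K by auto
    then have "subalgebra M (generated_sigma M K (\<lambda>k. B (\<tau> k)))"
      by (rule subalgebra_generated_sigma)
    then show ?thesis using A by (auto simp: subalgebra_def)
  qed
  show "(\<integral>\<omega>. indicator A \<omega> * (LINT s:{a..b}|lborel. B s \<omega> * eB T i s) \<partial>M) =
      (\<integral>\<omega>. indicator A \<omega> * (left_weight T i a b * B a \<omega> + right_weight T i a b * B b \<omega>) \<partial>M)"
  proof (cases "a < b")
    case False
    then have "a = b" using ab by simp
    then have "(LINT s:{a..b}|lborel. f s) = 0" for f :: "real \<Rightarrow> real"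
      using interval_integral_Icc[of b b f] by simp
    then show ?thesis using False by (simp add: left_weight_def right_weight_def)
  next
    case True
    define m where "m p = (\<integral>\<omega>. indicator A \<omega> * B p \<omega> \<partial>M)" for p
    have i: "integrable M (\<lambda>\<omega>. indicator A \<omega> * B p \<omega>)" if "p \<in> {a..b}" for p
      using integrable_mult_indicator[OF AM mom(2)[OF inT[OF that]]] by simp
    have "(\<integral>\<omega>. indicator A \<omega> * (LINT s:{a..b}|lborel. B s \<omega> * eB T i s) \<partial>M) =
        (LINT s:{a..b}|lborel. m s * eB T i s)"
      unfolding m_def by (rule Fubini(2)[OF _ _ _ AM])
    also have "\<dots> = (LINT s:{a..b}|lborel. ((b - s) * m a + (s - a) * m b) / (b - a) * eB T i s)"
    proof (rule set_lebesgue_integral_cong)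
      have "m s = ((b - s) * m a + (s - a) * m b) / (b - a)" if "s \<in> {a..b}" for s
        unfolding m_def by (rule brownian_bridge_interpolation[OF B K ab(1) True ab(3) gap that A])
      then show "\<forall>s. s \<in> {a..b} \<longrightarrow> m s * eB T i s = ((b - s) * m a + (s - a) * m b) / (b - a) * eB T i s"
        by metis
    qed simp
    also have "\<dots> = left_weight T i a b * m a + right_weight T i a b * m b"
      by (rule integral_linear_times_eB[OF T True])
    also have "\<dots> = (\<integral>\<omega>. left_weight T i a b * (indicator A \<omega> * B a \<omega>) + right_weight T i a b * (indicator A \<omega> * B b \<omega>) \<partial>M)"
      using i[of a] i[of b] ab by (simp add: m_def)
    also have "\<dots> = (\<integral>\<omega>. indicator A \<omega> * (left_weight T i a b * B a \<omega> + right_weight T i a b * B b \<omega>) \<partial>M)"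
      by (simp add: algebra_simps)
    finally show ?thesis .
  qed
qed

lemma alphaB_eq_weights:
  assumes n: "n \<ge> 1" and j: "j \<le> n" and mono: "\<And>j. j < n \<Longrightarrow> t j \<le> t (j + 1)"
  shows "alphaB T n t i j =
    (if j < n then left_weight T i (t j) (t (j + 1)) else 0) +
    (if 0 < j then right_weight T i (t (j - 1)) (t j) else 0)"
proof -
  consider "j = 0" | "j = n" "j \<noteq> 0" | "0 < j" "j < n" using j by linarith
  then show ?thesis
  proof cases
    case 1
    then show ?thesis using n mono[of 0] by (auto simp: alphaB_def left_weight_def)
  next
    case 2
    then show ?thesis using n mono[of "n - 1"] by (auto simp: alphaB_def right_weight_def)
  next
    case 3
    have le: "t (j - 1) \<le> t j" "t j \<le> t (j + 1)" using mono[of "j - 1"] mono[of j] 3 by auto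
    \<comment> \<open>the derivatives at \<open>t j\<close> in the two weights cancel, leaving a second difference\<close>
    have mid: "(y - x) / (b - a) - (z - y) / (c - b) =
        ((c - a) * y - (c - b) * x - (b - a) * z) / ((c - b) * (b - a))" if "a < b" "b < c"
      for a b c x y z :: real
    proof -
      have "(y - x) / (b - a) - (z - y) / (c - b) = ((y - x) * (c - b) - (z - y) * (b - a)) / ((b - a) * (c - b))"
        using that by (intro diff_frac_eq) auto
      then show ?thesis by (simp add: algebra_simps)
    qed
    show ?thesis
    proof (cases "t (j - 1) < t j \<and> t j < t (j + 1)")
      case True
      define x y z where "x = eB T i (t (j - 1))" and "y = eB T i (t j)" and "z = eB T i (t (j + 1))"
      have "left_weight T i (t j) (t (j + 1)) + right_weight T i (t (j - 1)) (t j) =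
          lambdaB T i * ((y - x) / (t j - t (j - 1)) - (z - y) / (t (j + 1) - t j))"
        unfolding left_weight_def right_weight_def x_def y_def z_def using True
        by (simp only: simp_thms if_True) (simp add: right_diff_distrib)
      also have "\<dots> = alphaB T n t i j"
        unfolding mid[OF conjunct1[OF True] conjunct2[OF True]] alphaB_def x_def y_def z_def
        using 3 True by simp
      finally show ?thesis using 3 by simp
    next
      case False
      then consider "t (j - 1) = t j" "t j < t (j + 1)" | "t (j - 1) < t j" "t j = t (j + 1)"
        | "t (j - 1) = t j" "t j = t (j + 1)" using le by linarith
      then show ?thesis
        using 3 by cases (simp_all add: alphaB_def left_weight_def right_weight_def)
    qed
  qed
qed

section \<open>The conditional expectation of the Karhunen-Loeve coordinates\<close>

theorem mainTheorem7:
  fixes M :: "'a measure" and T :: real and B :: "real \<Rightarrow> 'a \<Rightarrow> real"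
    and n i :: nat and t :: "nat \<Rightarrow> real"
  assumes "prob_space M"
    and "T > 0"
    and "brownian_bridge M T B"
    and "n \<ge> 1"
    and "t 0 = 0" and "t n = T" and "\<And>j. j < n \<Longrightarrow> t j \<le> t (j + 1)"
    and "i \<ge> 1"
  shows "AE \<omega> in M.
    real_cond_exp M (generated_sigma M {0..n} (\<lambda>j. B (t j)))
      (\<lambda>\<omega>. LINT s:{0..T}|lborel. B s \<omega> * eB T i s) \<omega>
    = (\<Sum>j=0..n. alphaB T n t i j * B (t j) \<omega>)"
proof -
  interpret prob_space M by (rule assms(1))
  note B = assms(3) and T = assms(2) assms(8) and tmono = assms(7)
  note mom = brownian_bridge_moments[OF B]
  define F where "F = generated_sigma M {0..n} (\<lambda>j. B (t j))"
  have mono: "t j \<le> t k" if "j \<le> k" "k \<le> n" for j k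
    using that tmono by (induction k rule: dec_induct) (auto intro: order_trans)
  have tT: "t j \<in> {0..T}" if "j \<le> n" for j
    using mono[of 0 j] mono[of j n] that assms(5,6) by auto
  have sub: "subalgebra M F"
    unfolding F_def using mom(2)[OF tT] by (intro subalgebra_generated_sigma) auto
  interpret S: finite_measure_subalgebra M F by standard (rule sub)
  define Y where "Y j \<omega> = (LINT s:{t j..t (j + 1)}|lborel. B s \<omega> * eB T i s)" for j \<omega>
  define Z where "Z j \<omega> = left_weight T i (t j) (t (j + 1)) * B (t j) \<omega>
      + right_weight T i (t j) (t (j + 1)) * B (t (j + 1)) \<omega>" for j \<omega>
  have gap: "t k \<le> t j \<or> t (j + 1) \<le> t k" if "j < n" "k \<in> {0..n}" for j k
    using mono[of k j] mono[of "j + 1" k] that by (cases "k \<le> j") auto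
  have Y: "integrable M (Y j)"
      "\<And>A. A \<in> sets F \<Longrightarrow> (\<integral>\<omega>. indicator A \<omega> * Y j \<omega> \<partial>M) = (\<integral>\<omega>. indicator A \<omega> * Z j \<omega> \<partial>M)"
    if "j < n" for j
    using brownian_bridge_subinterval[OF B T, of "{0..n}" t "t j" "t (j + 1)"]
      tT[of j] tT[of "j + 1"] tT gap[OF that] tmono[OF that] that
    unfolding Y_def Z_def F_def by (auto simp: image_subset_iff)
  have Z: "integrable M (Z j)" if "j < n" for j
    unfolding Z_def using mom(2)[OF tT] that by auto
  have sumY: "(LINT s:{0..T}|lborel. B s \<omega> * eB T i s) = (\<Sum>j<n. Y j \<omega>)" if "\<omega> \<in> space M" for \<omega>
  proof -
    have "continuous_on {0..T} (\<lambda>s. B s \<omega>)" using B that by (simp add: brownian_bridge_def)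
    moreover have "continuous_on {0..T} (eB T i)"
      by (rule DERIV_continuous_on[OF DERIV_subset[OF eB_derivatives(1)[OF T]]]) simp
    ultimately have "continuous_on {0..T} (\<lambda>s. B s \<omega> * eB T i s)" by (rule continuous_on_mult)
    then show ?thesis
      using set_integral_chain[where t = t and n = n and f = "\<lambda>s. B s \<omega> * eB T i s", OF tmono] assms(5,6) by (simp add: Y_def)
  qed
  have sumZ: "(\<Sum>j=0..n. alphaB T n t i j * B (t j) \<omega>) = (\<Sum>j<n. Z j \<omega>)" for \<omega>
  proof -
    obtain m where m: "n = Suc m" using assms(4) by (cases n) auto
    \<comment> \<open>regroup the two weights at each grid point by subintervals\<close>
    have "(\<Sum>j=0..n. alphaB T n t i j * B (t j) \<omega>) =
       (\<Sum>j=0..n. (if j < n then left_weight T i (t j) (t (j + 1)) * B (t j) \<omega> else 0) +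
         (if 0 < j then right_weight T i (t (j - 1)) (t j) * B (t j) \<omega> else 0))"
      by (rule sum.cong) (auto simp: alphaB_eq_weights[where n = n and t = t, OF assms(4) _ tmono] algebra_simps)
    also have "\<dots> = (\<Sum>j\<le>n. if j < n then left_weight T i (t j) (t (j + 1)) * B (t j) \<omega> else 0) +
         (\<Sum>j\<le>n. if 0 < j then right_weight T i (t (j - 1)) (t j) * B (t j) \<omega> else 0)"
      by (simp add: sum.distrib atMost_atLeast0)
    also have "(\<Sum>j\<le>n. if j < n then left_weight T i (t j) (t (j + 1)) * B (t j) \<omega> else 0) =
        (\<Sum>j<n. left_weight T i (t j) (t (j + 1)) * B (t j) \<omega>)"
      by (simp add: lessThan_Suc_atMost[symmetric])
    also have "(\<Sum>j\<le>n. if 0 < j then right_weight T i (t (j - 1)) (t j) * B (t j) \<omega> else 0) =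
        (\<Sum>j<n. right_weight T i (t j) (t (j + 1)) * B (t (j + 1)) \<omega>)"
      unfolding m sum.atMost_Suc_shift by (simp add: lessThan_Suc_atMost)
    finally show ?thesis by (simp add: Z_def sum.distrib)
  qed
  have intL: "integrable M (\<lambda>\<omega>. LINT s:{0..T}|lborel. B s \<omega> * eB T i s)"
  proof -
    have "integrable M (\<lambda>\<omega>. \<Sum>j<n. Y j \<omega>)" using Y(1) by (intro Bochner_Integration.integrable_sum) auto
    then show ?thesis
      by (rule Bochner_Integration.integrable_cong[THEN iffD1, rotated 2]) (simp_all add: sumY)
  qed
  show ?thesis
    unfolding F_def[symmetric] sumZ
  proof (rule S.real_cond_exp_charact[OF _ intL])
    show "integrable M (\<lambda>\<omega>. \<Sum>j<n. Z j \<omega>)" using Z by auto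
    have "B (t j) \<in> borel_measurable F" if "j \<le> n" for j
      unfolding F_def by (rule measurable_generated_sigma[where X = "\<lambda>j. B (t j)"]) (use that in auto)
    then show "(\<lambda>\<omega>. \<Sum>j<n. Z j \<omega>) \<in> borel_measurable F"
      unfolding Z_def by (intro borel_measurable_sum borel_measurable_add borel_measurable_times) auto
    fix A assume A: "A \<in> sets F"
    then have AM: "A \<in> sets M" using sub by (auto simp: subalgebra_def)
    have i: "integrable M (\<lambda>\<omega>. indicator A \<omega> * f \<omega>)" if "integrable M f" for f :: "'a \<Rightarrow> real"
      using integrable_mult_indicator[OF AM that] by simp
    have "(\<integral>\<omega>\<in>A. (LINT s:{0..T}|lborel. B s \<omega> * eB T i s) \<partial>M) = (\<integral>\<omega>. (\<Sum>j<n. indicator A \<omega> * Y j \<omega>) \<partial>M)"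
      unfolding set_lebesgue_integral_def[of M]
      by (rule Bochner_Integration.integral_cong) (auto simp: sumY sum_distrib_left)
    also have "\<dots> = (\<Sum>j<n. \<integral>\<omega>. indicator A \<omega> * Y j \<omega> \<partial>M)"
      by (rule Bochner_Integration.integral_sum) (use i Y(1) in auto)
    also have "\<dots> = (\<Sum>j<n. \<integral>\<omega>. indicator A \<omega> * Z j \<omega> \<partial>M)" using Y(2) A by auto
    also have "\<dots> = (\<integral>\<omega>. (\<Sum>j<n. indicator A \<omega> * Z j \<omega>) \<partial>M)"
      by (rule Bochner_Integration.integral_sum[symmetric]) (use i Z in auto)
    also have "\<dots> = (\<integral>\<omega>\<in>A. (\<Sum>j<n. Z j \<omega>) \<partial>M)"
      by (simp add: set_lebesgue_integral_def sum_distrib_left)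
    finally show "(\<integral>\<omega>\<in>A. (LINT s:{0..T}|lborel. B s \<omega> * eB T i s) \<partial>M) = (\<integral>\<omega>\<in>A. (\<Sum>j<n. Z j \<omega>) \<partial>M)" .
  qed
qed

end
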